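(* Let $n\ge1$ and $\lambda=(\lambda_1,\ldots,\lambda_n)\in\mathbb{R}^n$ with $0<\lambda_1<\cdots<\lambda_n$, and let $\mathfrak{g}_\lambda$ be the associated oscillator Lie algebra. If $J:\mathfrak{g}_\lambda\to\mathfrak{g}_\lambda$ is a derivation of the Lie algebra $\mathfrak{g}_\lambda$ satisfying $J(e_0)=J(e_{-1})=0$, then there exists $(\mu_1,\ldots,\mu_n)\in\mathbb{R}^n$ such that, for every $i\in\{1,\ldots,n\}$, $$J(e_i)=\mu_i\check e_i\quad\text{and}\quad J(\check e_i)=-\mu_ie_i.$$
   Context: Oscillator Lie algebra: for $n\ge1$ and $\lambda=(\lambda_1,\ldots,\lambda_n)\in\mathbb{R}^n$ with $0<\lambda_1\le\cdots\le\lambda_n$, $\mathfrak{g}_\lambda$ is the real Lie algebra of dimension $2n+2$ with basis $\{e_{-1},e_0,e_i,\check e_i\}_{i=1,\ldots,n}$ and brackets $$[e_{-1},e_i]=\lambda_i\check e_i,\qquad [e_{-1},\check e_i]=-\lambda_i e_i,\qquad [e_i,\check e_i]=e_0,\qquad i=1,\ldots,n,$$ the unspecified brackets of basis elements being given by antisymmetry or zero. *)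

theory Defs
  imports "HOL-Analysis.Analysis"
begin

locale lie_algebra =
  fixes br :: "'a::real_vector \<Rightarrow> 'a \<Rightarrow> 'a"
  assumes bilinear_br: "bilinear br"
    and br_self: "br x x = 0"
    and jacobi: "br x (br y z) + br y (br z x) + br z (br x y) = 0"

definition lie_derivation :: "('a::real_vector \<Rightarrow> 'a \<Rightarrow> 'a) \<Rightarrow> ('a \<Rightarrow> 'a) \<Rightarrow> bool" where
  "lie_derivation br D \<longleftrightarrow>
     linear D \<and> (\<forall>x y. D (br x y) = br (D x) y + br x (D y))"

text \<open>
  The underlying vector space is the whole type \<^typ>\<open>'a\<close>. The vectors \<open>em\<close>, \<open>e0\<close>, \<open>e i\<close>, \<open>ec i\<close>
  stand for $e_{-1}$, $e_0$, $e_i$, $\check e_i$; only the values of \<open>e\<close>, \<open>ec\<close> and \<open>lam\<close> on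
  \<open>{1..n}\<close> matter. The cardinality condition makes the listed basis vectors pairwise distinct.
\<close>

locale oscillator_algebra = lie_algebra br
  for br :: "'a::real_vector \<Rightarrow> 'a \<Rightarrow> 'a" +
  fixes n :: nat
    and lam :: "nat \<Rightarrow> real"
    and em e0 :: 'a
    and e ec :: "nat \<Rightarrow> 'a"
  assumes n_ge_1: "n \<ge> 1"
    and lam_pos: "i \<in> {1..n} \<Longrightarrow> 0 < lam i"
    and lam_mono: "mono_on {1..n} lam"
    and basis_card: "card ({em, e0} \<union> e ` {1..n} \<union> ec ` {1..n}) = 2 * n + 2"
    and basis_independent: "independent ({em, e0} \<union> e ` {1..n} \<union> ec ` {1..n})"
    and basis_span: "span ({em, e0} \<union> e ` {1..n} \<union> ec ` {1..n}) = UNIV"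
    and br_em_e: "i \<in> {1..n} \<Longrightarrow> br em (e i) = lam i *\<^sub>R ec i"
    and br_em_ec: "i \<in> {1..n} \<Longrightarrow> br em (ec i) = - lam i *\<^sub>R e i"
    and br_e_ec: "i \<in> {1..n} \<Longrightarrow> br (e i) (ec i) = e0"
    and br_em_e0: "br em e0 = 0"
    and br_e0_e: "i \<in> {1..n} \<Longrightarrow> br e0 (e i) = 0"
    and br_e0_ec: "i \<in> {1..n} \<Longrightarrow> br e0 (ec i) = 0"
    and br_e_e: "\<lbrakk>i \<in> {1..n}; j \<in> {1..n}\<rbrakk> \<Longrightarrow> br (e i) (e j) = 0"
    and br_ec_ec: "\<lbrakk>i \<in> {1..n}; j \<in> {1..n}\<rbrakk> \<Longrightarrow> br (ec i) (ec j) = 0"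
    and br_e_ec_neq: "\<lbrakk>i \<in> {1..n}; j \<in> {1..n}; i \<noteq> j\<rbrakk> \<Longrightarrow> br (e i) (ec j) = 0"

text \<open>
  The locale is inhabited for every \<open>n\<close> and every admissible \<open>lam\<close>: the type index of the model
  has \<open>2 * n + 2\<close> elements when \<open>CARD('n) = n\<close>.
\<close>

definition osc_br ::
    "('n \<Rightarrow> real) \<Rightarrow> real ^ (('n::finite + 'n) + bool) \<Rightarrow> real ^ (('n + 'n) + bool)
      \<Rightarrow> real ^ (('n + 'n) + bool)" where
  "osc_br l x y = (\<chi> k. case k of
      Inl (Inl i) \<Rightarrow> l i * (x $ Inl (Inr i) * y $ Inr True - x $ Inr True * y $ Inl (Inr i))
    | Inl (Inr i) \<Rightarrow> l i * (x $ Inr True * y $ Inl (Inl i) - x $ Inl (Inl i) * y $ Inr True)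
    | Inr b \<Rightarrow> if b then 0
        else (\<Sum>i\<in>UNIV. x $ Inl (Inl i) * y $ Inl (Inr i) - x $ Inl (Inr i) * y $ Inl (Inl i)))"

lemma osc_br_nth [simp]:
  "osc_br l x y $ Inl (Inl i) = l i * (x $ Inl (Inr i) * y $ Inr True - x $ Inr True * y $ Inl (Inr i))"
  "osc_br l x y $ Inl (Inr i) = l i * (x $ Inr True * y $ Inl (Inl i) - x $ Inl (Inl i) * y $ Inr True)"
  "osc_br l x y $ Inr True = 0"
  "osc_br l x y $ Inr False =
     (\<Sum>i\<in>UNIV. x $ Inl (Inl i) * y $ Inl (Inr i) - x $ Inl (Inr i) * y $ Inl (Inl i))"
  by (simp_all add: osc_br_def)

lemma osc_vec_eqI:
  fixes x y :: "real ^ (('n::finite + 'n) + bool)"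
  assumes "\<And>i. x $ Inl (Inl i) = y $ Inl (Inl i)" "\<And>i. x $ Inl (Inr i) = y $ Inl (Inr i)"
    "x $ Inr True = y $ Inr True" "x $ Inr False = y $ Inr False"
  shows "x = y"
proof -
  have "x $ k = y $ k" for k
  proof (cases k)
    case (Inl a) then show ?thesis using assms by (cases a) auto
  next
    case (Inr b) then show ?thesis using assms by (cases b) auto
  qed
  then show ?thesis by (simp add: vec_eq_iff)
qed

lemma lie_algebra_osc_br: "lie_algebra (osc_br l)"
proof
  show "bilinear (osc_br l)"
    unfolding bilinear_def
    by (auto intro!: linearI osc_vec_eqI
        simp: algebra_simps sum.distrib sum_subtractf sum_distrib_left)
  show "osc_br l x x = 0" for x
    by (rule osc_vec_eqI) (auto simp: algebra_simps)
  show "osc_br l x (osc_br l y z) + osc_br l y (osc_br l z x) + osc_br l z (osc_br l x y) = 0"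
    for x y z
    by (rule osc_vec_eqI)
      (auto simp: algebra_simps sum.distrib[symmetric] sum_subtractf[symmetric] intro!: sum.neutral)
qed

lemma oscillator_algebra_model:
  fixes lam :: "nat \<Rightarrow> real"
  assumes pos: "\<And>i. i \<in> {1..CARD('n::finite)} \<Longrightarrow> 0 < lam i"
    and mono: "mono_on {1..CARD('n)} lam"
  shows "\<exists>(br :: real ^ (('n + 'n) + bool) \<Rightarrow> _) em e0 e ec.
           oscillator_algebra br CARD('n) lam em e0 e ec"
proof -
  let ?n = "CARD('n)"
  obtain f :: "nat \<Rightarrow> 'n" where f: "bij_betw f {1..?n} UNIV"
    using ex_bij_betw_nat_finite_1[OF finite_class.finite_UNIV] by blast
  define g where "g = the_inv_into {1..?n} f"
  have gf: "g (f i) = i" if "i \<in> {1..?n}" for i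
    using f that unfolding g_def bij_betw_def by (auto intro: the_inv_into_f_f)
  have finj: "f i = f j \<longleftrightarrow> i = j" if "i \<in> {1..?n}" "j \<in> {1..?n}" for i j
    using gf that by metis
  define l where "l = lam \<circ> g"
  have l: "l (f i) = lam i" if "i \<in> {1..?n}" for i
    using gf[OF that] by (simp add: l_def)
  define em e0 :: "real ^ (('n + 'n) + bool)" where "em = axis (Inr True) 1" and "e0 = axis (Inr False) 1"
  define e ec :: "nat \<Rightarrow> real ^ (('n + 'n) + bool)"
    where "e = (\<lambda>i. axis (Inl (Inl (f i))) 1)" and "ec = (\<lambda>i. axis (Inl (Inr (f i))) 1)"
  have img: "(\<lambda>i. h (f i)) ` {1..?n} = range h" for h :: "'n \<Rightarrow> real ^ (('n + 'n) + bool)"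
    using f unfolding bij_betw_def by (metis image_image)
  have univ: "(UNIV :: (('n + 'n) + bool) set) =
      {Inr True, Inr False} \<union> range (Inl \<circ> Inl) \<union> range (Inl \<circ> Inr)"
  proof -
    have "k \<in> {Inr True, Inr False} \<union> range (Inl \<circ> Inl) \<union> range (Inl \<circ> Inr)"
      for k :: "('n + 'n) + bool"
    proof (cases k)
      case (Inl a) then show ?thesis by (cases a) auto
    next
      case (Inr b) then show ?thesis by (cases b) auto
    qed
    then show ?thesis by blast
  qed
  have B: "{em, e0} \<union> e ` {1..?n} \<union> ec ` {1..?n} = (Basis :: (real ^ (('n + 'n) + bool)) set)"
  proof -
    have "(Basis :: (real ^ (('n + 'n) + bool)) set) = range (\<lambda>k. axis k 1)"
      by (auto simp: Basis_vec_def)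
    also have "\<dots> = {em, e0} \<union> range (\<lambda>i. axis (Inl (Inl i)) 1) \<union> range (\<lambda>i. axis (Inl (Inr i)) 1)"
      unfolding univ by (simp add: image_Un image_image em_def e0_def comp_def)
    finally show ?thesis
      unfolding e_def ec_def
        img[of "\<lambda>i. axis (Inl (Inl i)) 1"] img[of "\<lambda>i. axis (Inl (Inr i)) 1"] by (rule sym)
  qed
  interpret lie_algebra "osc_br l" by (rule lie_algebra_osc_br)
  have "oscillator_algebra (osc_br l) ?n lam em e0 e ec"
  proof
    show "1 \<le> ?n" by (simp add: Suc_leI)
    show "card ({em, e0} \<union> e ` {1..?n} \<union> ec ` {1..?n}) = 2 * ?n + 2"
      unfolding B by simp
    show "independent ({em, e0} \<union> e ` {1..?n} \<union> ec ` {1..?n})"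
      unfolding B by (rule independent_Basis)
    show "span ({em, e0} \<union> e ` {1..?n} \<union> ec ` {1..?n}) = UNIV"
      unfolding B by (rule span_Basis)
  qed (use pos mono in \<open>auto intro!: osc_vec_eqI sum.neutral
        simp: em_def e0_def e_def ec_def axis_def l finj if_distrib if_distribR cong: if_cong\<close>)
  then show ?thesis by blast
qed

end

theory Submission
  imports Defs
begin

text \<open>
  Since \<open>J\<close> kills $e_{-1}$, it commutes with $T = \mathrm{ad}\,e_{-1}$. The operator $T^2$ is diagonal
  in the given basis, with eigenvalue $-\lambda_i^2$ on $e_i, \check e_i$ and $0$ on $e_{-1}, e_0$;
  as the $\lambda_i$ are distinct and positive, \<open>J\<close> preserves each plane spanned by $e_i, \check e_i$.
  There \<open>J\<close> commutes with the rotation $T$, so $J e_i = p e_i + q \check e_i$ and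
  $J \check e_i = p \check e_i - q e_i$. Applying \<open>J\<close> to $[e_i, \check e_i] = e_0$ gives $2 p e_0 = 0$.
\<close>

text \<open>Write \<open>v\<close> as a finite combination of vectors of \<open>B\<close> with
  coefficients \<open>r b\<close>, and let \<open>c b\<close> be the eigenvalue of \<open>b\<close>.
  Then \<open>S v - k *\<^sub>R v = 0\<close> has coefficients \<open>r b * (c b - k)\<close>, so by
  independence every \<open>b\<close> that really occurs in \<open>v\<close> has eigenvalue
  \<open>k\<close>.\<close>

lemma eigenvector_in_span_eigenbasis:
  fixes S :: "'a::real_vector \<Rightarrow> 'a"
  assumes lin: "linear S" and ind: "independent B" and v: "v \<in> span B"
    and diag: "\<And>b. b \<in> B \<Longrightarrow> \<exists>c. S b = c *\<^sub>R b"
    and eig: "S v = k *\<^sub>R v"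
  shows "v \<in> span {b \<in> B. S b = k *\<^sub>R b}"
proof -
  obtain c where c: "\<And>b. b \<in> B \<Longrightarrow> S b = c b *\<^sub>R b"
    using diag by metis
  obtain A r where A: "finite A" "A \<subseteq> B" and v_eq: "v = (\<Sum>b\<in>A. r b *\<^sub>R b)"
    using v unfolding span_explicit by blast
  have Sv: "S v = (\<Sum>b\<in>A. (r b * c b) *\<^sub>R b)"
    unfolding v_eq linear_sum[OF lin]
    by (rule sum.cong) (use A c in \<open>auto simp: linear_scale[OF lin]\<close>)
  have zero: "(\<Sum>b\<in>A. (r b * (c b - k)) *\<^sub>R b) = S v - k *\<^sub>R v"
    unfolding Sv
    by (simp add: v_eq scaleR_sum_right sum_subtractf[symmetric] left_diff_distrib
        right_diff_distrib mult_ac scaleR_left_diff_distrib)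
  have coeff: "r b * (c b - k) = 0" if "b \<in> A" for b
    by (rule independentD[OF ind A _ that]) (simp add: zero eig)
  show ?thesis
    unfolding v_eq
  proof (rule span_sum)
    fix b assume b: "b \<in> A"
    show "r b *\<^sub>R b \<in> span {b \<in> B. S b = k *\<^sub>R b}"
    proof (cases "r b = 0")
      case False
      then have "S b = k *\<^sub>R b" "b \<in> B"
        using coeff[OF b] c A b by auto
      then show ?thesis by (intro span_scale span_base) simp
    qed (simp add: span_zero)
  qed
qed

theorem lemma2p1:
  fixes br :: "'a::real_vector \<Rightarrow> 'a \<Rightarrow> 'a"
    and n :: nat
    and lam :: "nat \<Rightarrow> real"
    and em e0 :: 'a
    and e ec :: "nat \<Rightarrow> 'a"
    and J :: "'a \<Rightarrow> 'a"
  assumes "oscillator_algebra br n lam em e0 e ec"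
    and "strict_mono_on {1..n} lam"
    and "lie_derivation br J"
    and "J e0 = 0"
    and "J em = 0"
  shows "\<exists>\<mu> :: nat \<Rightarrow> real. \<forall>i\<in>{1..n}. J (e i) = \<mu> i *\<^sub>R ec i \<and> J (ec i) = - \<mu> i *\<^sub>R e i"
proof -
  interpret oscillator_algebra br n lam em e0 e ec by fact
  let ?B = "{em, e0} \<union> e ` {1..n} \<union> ec ` {1..n}"
  let ?T = "br em"
  let ?S = "\<lambda>x. ?T (?T x)"
  have linJ: "linear J" and der: "J (br x y) = br (J x) y + br x (J y)" for x y
    using assms(3) by (auto simp: lie_derivation_def)
  note bil = bilinear_ladd[OF bilinear_br] bilinear_radd[OF bilinear_br]
    bilinear_lmul[OF bilinear_br] bilinear_rmul[OF bilinear_br]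
    bilinear_lzero[OF bilinear_br] bilinear_rzero[OF bilinear_br]
  have linS: "linear ?S"
    by (rule linearI) (simp_all add: bil)
  have JT: "J (?T x) = ?T (J x)" for x
    using der[of em x] assms(5) by (simp add: bil)
  have nonzero: "b \<noteq> 0" if "b \<in> ?B" for b
  proof
    assume "b = 0"
    then have "dependent ?B" using that by (intro dependent_zero) simp
    then show False using basis_independent by contradiction
  qed
  have Se: "?S (e j) = (- (lam j)\<^sup>2) *\<^sub>R e j" and Sec: "?S (ec j) = (- (lam j)\<^sup>2) *\<^sub>R ec j"
    if "j \<in> {1..n}" for j
    using that by (simp_all only: br_em_e br_em_ec bil) (simp_all add: power2_eq_square)
  have S0: "?S em = 0" "?S e0 = 0"
    by (simp_all add: br_self br_em_e0 bil)
  have diag: "\<exists>c. ?S b = c *\<^sub>R b" if b: "b \<in> ?B" for b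
  proof -
    consider "b \<in> {em, e0}" | j where "j \<in> {1..n}" "b = e j \<or> b = ec j"
      using b by auto
    then show ?thesis
    proof cases
      case 1
      then have "?S b = 0 *\<^sub>R b" using S0 by auto
      then show ?thesis ..
    next
      case 2
      then show ?thesis using Se Sec by blast
    qed
  qed
  have "\<exists>q. J (e i) = q *\<^sub>R ec i \<and> J (ec i) = - q *\<^sub>R e i" if i: "i \<in> {1..n}" for i
  proof -
    have eigenplane: "{b \<in> ?B. ?S b = (- (lam i)\<^sup>2) *\<^sub>R b} \<subseteq> {e i, ec i}"
    proof
      fix b assume b: "b \<in> {b \<in> ?B. ?S b = (- (lam i)\<^sup>2) *\<^sub>R b}"
      \<comment> \<open>Positivity recovers \<open>lam j\<close> from its square; strict
        monotonicity then recovers the index.\<close>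
      have same: "j = i" if j: "j \<in> {1..n}" and "(lam j)\<^sup>2 = (lam i)\<^sup>2" for j
      proof -
        have "lam j = lam i"
          using that lam_pos[OF j] lam_pos[OF i] by (simp add: power2_eq_iff)
        then show ?thesis
          using strict_mono_on_imp_inj_on[OF assms(2)] i j by (auto dest: inj_onD)
      qed
      have b0: "b \<noteq> 0" and Sb: "?S b = (- (lam i)\<^sup>2) *\<^sub>R b"
        using b nonzero by auto
      consider "b \<in> {em, e0}" | j where "j \<in> {1..n}" "b = e j" | j where "j \<in> {1..n}" "b = ec j"
        using b by auto
      then show "b \<in> {e i, ec i}"
      proof cases
        case 1
        \<comment> \<open>On \<open>em\<close> and \<open>e0\<close> the eigenvalue is 0, which
          differs from \<open>- (lam i)\<^sup>2\<close>, so this case is contradictory.\<close>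
        then have "(- (lam i)\<^sup>2) *\<^sub>R b = 0" using S0 Sb by auto
        then show ?thesis using b0 lam_pos[OF i] by simp
      next
        case 2
        then have "(- (lam j)\<^sup>2) *\<^sub>R b = (- (lam i)\<^sup>2) *\<^sub>R b" using Se Sb by simp
        then have "(lam j)\<^sup>2 = (lam i)\<^sup>2" using b0 by (simp only: scaleR_cancel_right) simp
        then show ?thesis using same 2 by blast
      next
        case 3
        then have "(- (lam j)\<^sup>2) *\<^sub>R b = (- (lam i)\<^sup>2) *\<^sub>R b" using Sec Sb by simp
        then have "(lam j)\<^sup>2 = (lam i)\<^sup>2" using b0 by (simp only: scaleR_cancel_right) simp
        then show ?thesis using same 3 by blast
      qed
    qed
    \<comment> \<open>Commuting with \<open>?S\<close>, \<open>J\<close> maps each eigenspace of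
      \<open>?S\<close> into itself.\<close>
    have "?S (J (e i)) = J (?S (e i))"
      by (simp only: JT)
    then have "?S (J (e i)) = (- (lam i)\<^sup>2) *\<^sub>R J (e i)"
      by (simp only: Se[OF i] linear_scale[OF linJ])
    then have "J (e i) \<in> span {b \<in> ?B. ?S b = (- (lam i)\<^sup>2) *\<^sub>R b}"
      by (intro eigenvector_in_span_eigenbasis linS basis_independent diag)
        (simp_all only: basis_span UNIV_I)
    then have "J (e i) \<in> span {e i, ec i}"
      using span_mono[OF eigenplane] by blast
    then obtain p q where Je: "J (e i) = p *\<^sub>R e i + q *\<^sub>R ec i"
      by (auto simp: span_breakdown_eq algebra_simps)
    \<comment> \<open>No second eigenspace argument is made for \<open>ec i\<close>: it is
      \<open>?T (e i)\<close> up to the nonzero factor \<open>lam i\<close>, so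
      \<open>J (ec i)\<close> follows from \<open>J (e i)\<close> by commuting \<open>J\<close> past
      \<open>?T\<close>.\<close>
    have "lam i *\<^sub>R J (ec i) = J (?T (e i))"
      by (simp add: br_em_e[OF i] linear_scale[OF linJ])
    also have "\<dots> = lam i *\<^sub>R (p *\<^sub>R ec i - q *\<^sub>R e i)"
      unfolding JT Je by (simp add: bil br_em_e[OF i] br_em_ec[OF i] algebra_simps)
    finally have Jec: "J (ec i) = p *\<^sub>R ec i - q *\<^sub>R e i"
      using lam_pos[OF i] by simp
    \<comment> \<open>Each of the two brackets contributes \<open>p *\<^sub>R e0\<close>; the terms
      in \<open>q\<close> are brackets of a vector with itself and vanish. Since \<open>e0\<close>
      is a nonzero basis vector, \<open>p\<close> must be 0, leaving \<open>q\<close> as the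
      required \<mu> at \<open>i\<close>.\<close>
    have "0 = br (J (e i)) (ec i) + br (e i) (J (ec i))"
      using der[of "e i" "ec i"] br_e_ec[OF i] assms(4) by simp
    also have "\<dots> = (2 * p) *\<^sub>R e0"
      by (simp add: Je Jec bil bilinear_rsub[OF bilinear_br] br_self br_e_ec[OF i] scaleR_add_left[symmetric])
    finally have "p = 0" using nonzero[of e0] by simp
    then show ?thesis using Je Jec by auto
  qed
  then show ?thesis by metis
qed

end
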